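(* Let $p\equiv 1\pmod 4$ be a prime. Let $X=\{(a,b)\in V\times V : a<b<\overline{a}<\overline{b}\}$, $Y=\{(a,b)\in V\times V : a<\overline{a}<b<\overline{b}\}$, $Z=\{(a,b)\in V\times V : a<b<\overline{b}<\overline{a}\}$. Then $|X|=|Y|=|Z|=(p-1)(p-5)/96$.
   Context: For an integer $x$, $\{x\}_p$ denotes the least nonnegative residue of $x$ modulo $p$, and $\widetilde{x}=p-\{x\}_p$ if $\{x\}_p>p/2$, while $\widetilde{x}=\{x\}_p$ if $\{x\}_p<p/2$. Let $t=\prod_{x=1}^{(p-1)/2}x$ (so $t^2\equiv-1\pmod p$). Let $V=\{x : 1\le x\le (p-1)/2,\ x<\widetilde{tx}\}$, and for $a\in V$ put $\overline{a}=\widetilde{ta}$; the pairs $(a,\overline{a})$, $a\in V$, partition $\{1,\ldots,(p-1)/2\}$. *)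

theory Defs
  imports Complex_Main "HOL-Number_Theory.Cong" "HOL-Computational_Algebra.Primes"
begin

text \<open>
  \<open>tilde p x\<close> is the distance from the integer \<open>x\<close> to the nearest multiple of \<open>p\<close>. Only odd \<open>p\<close>
  are of interest, so the residue is never equal to \<open>p / 2\<close>.
\<close>

definition tilde :: "int \<Rightarrow> int \<Rightarrow> int" where
  "tilde p x = (if real_of_int (x mod p) > real_of_int p / 2 then p - x mod p else x mod p)"

definition tval :: "int \<Rightarrow> int" where
  "tval p = \<Prod>{1..(p - 1) div 2}"

definition pbar :: "int \<Rightarrow> int \<Rightarrow> int" where
  "pbar p a = tilde p (tval p * a)"

definition V :: "int \<Rightarrow> int set" where
  "V p = {x. 1 \<le> x \<and> x \<le> (p - 1) div 2 \<and> x < tilde p (tval p * x)}"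

definition X :: "int \<Rightarrow> (int \<times> int) set" where
  "X p = {(a, b) \<in> V p \<times> V p. a < b \<and> b < pbar p a \<and> pbar p a < pbar p b}"

definition Y :: "int \<Rightarrow> (int \<times> int) set" where
  "Y p = {(a, b) \<in> V p \<times> V p. a < pbar p a \<and> pbar p a < b \<and> b < pbar p b}"

definition Z :: "int \<Rightarrow> (int \<times> int) set" where
  "Z p = {(a, b) \<in> V p \<times> V p. a < b \<and> b < pbar p b \<and> pbar p b < pbar p a}"

end

theory Submission
  imports Defs "HOL-Number_Theory.Residues" "HOL-Library.Centered_Division"
begin

text \<open>
  Let \<open>n = (p - 1) / 2\<close> and regard each pair \<open>(a, bar a)\<close>, \<open>a \<in> V\<close>, as an arc on the points
  \<open>1, \<dots>, n\<close>. Two arcs cross (\<open>X\<close>), are disjoint (\<open>Y\<close>) or are nested (\<open>Z\<close>), which gives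
  \<open>|X| + |Y| + |Z| = n (n - 2) / 8\<close>.

  The sum of \<open>sgn (y - x) sgn (y - bar x)\<close> over all points \<open>x, y\<close> is \<open>8 |Y|\<close>; for fixed \<open>x\<close> the
  inner sum is \<open>n - 2 |bar x - x|\<close>. Multiplication by \<open>t - 1\<close> shows that \<open>|bar x - x|\<close> and
  \<open>min x (bar x)\<close> have the same sum \<open>s\<close> over all points, and
  \<open>2 min x (bar x) + |bar x - x| = x + bar x\<close> then gives \<open>3 s = n (n + 1)\<close>. Hence
  \<open>|Y| = n (n - 2) / 24\<close>.

  The sum of \<open>sgn (y - x) sgn (bar y - bar x)\<close> is \<open>8 (|Y| - |Z|) - n\<close>. Extended to all residues
  and rewritten in the coordinates \<open>x = v - u\<close>, \<open>y = v + u\<close>, it factors into a square, and its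
  value becomes \<open>S\<^sup>2 - n\<close>, where \<open>S\<close> is the sum over all points \<open>u\<close> of the sign of the residue
  \<open>t u cmod p\<close> of least absolute value. Replacing \<open>u\<close> by \<open>bar u\<close> reverses this sign, so \<open>S = 0\<close>
  and \<open>|Y| = |Z|\<close>.
\<close>

section \<open>Pairs of arcs of a fixed-point-free involution\<close>

lemma sum_sum_eq_sum_less_pairs:
  fixes A :: "'a::linorder set" and F :: "'a \<Rightarrow> 'a \<Rightarrow> 'b::comm_monoid_add"
  assumes "finite A"
  shows "(\<Sum>a\<in>A. \<Sum>b\<in>A. F a b)
    = (\<Sum>a\<in>A. F a a) + (\<Sum>(a, b)\<in>{(a, b) \<in> A \<times> A. a < b}. F a b + F b a)"
proof -
  define diag below above where "diag = {(a, b) \<in> A \<times> A. a = b}"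
    and "below = {(a, b) \<in> A \<times> A. a < b}" and "above = {(a, b) \<in> A \<times> A. b < a}"
  let ?F = "\<lambda>(a, b). F a b"
  have fin: "finite diag" "finite below" "finite above"
    by (rule finite_subset[of _ "A \<times> A"]; use assms in \<open>auto simp: diag_def below_def above_def\<close>)+
  have "(\<Sum>a\<in>A. \<Sum>b\<in>A. F a b) = sum ?F (A \<times> A)"
    by (simp add: sum.cartesian_product)
  also have "A \<times> A = diag \<union> (below \<union> above)"
    by (auto simp: diag_def below_def above_def)
  also have "sum ?F \<dots> = sum ?F diag + (sum ?F below + sum ?F above)"
    using fin by (subst sum.union_disjoint; (auto simp: diag_def below_def above_def)?)+
  also have "sum ?F diag = (\<Sum>a\<in>A. F a a)"
    by (rule sum.reindex_bij_witness[where i = "\<lambda>a. (a, a)" and j = fst]) (auto simp: diag_def)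
  also have "sum ?F above = (\<Sum>(a, b)\<in>below. F b a)"
    by (rule sum.reindex_bij_witness[where i = prod.swap and j = prod.swap])
      (auto simp: below_def above_def)
  finally show ?thesis
    by (simp add: below_def sum.distrib case_prod_unfold)
qed

locale fixpoint_free_involution =
  fixes S :: "'a::linordered_idom set" and f :: "'a \<Rightarrow> 'a"
  assumes finite: "finite S"
    and closed: "x \<in> S \<Longrightarrow> f x \<in> S"
    and involution: "x \<in> S \<Longrightarrow> f (f x) = x"
    and no_fixpoint: "x \<in> S \<Longrightarrow> f x \<noteq> x"
begin

definition openers :: "'a set" where
  "openers = {x \<in> S. x < f x}"

definition crossings :: "('a \<times> 'a) set" where
  "crossings = {(a, b) \<in> openers \<times> openers. a < b \<and> b < f a \<and> f a < f b}"

definition alignments :: "('a \<times> 'a) set" where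
  "alignments = {(a, b) \<in> openers \<times> openers. f a < b}"

definition nestings :: "('a \<times> 'a) set" where
  "nestings = {(a, b) \<in> openers \<times> openers. a < b \<and> f b < f a}"

lemma finite_openers: "finite openers"
  using finite by (simp add: openers_def)

lemma sum_eq_sum_openers: "(\<Sum>x\<in>S. g x) = (\<Sum>a\<in>openers. g a + g (f a))"
  for g :: "'a \<Rightarrow> 'b::comm_monoid_add"
proof -
  have "S \<subseteq> openers \<union> f ` openers"
  proof
    fix x assume x: "x \<in> S"
    then have "x \<in> openers \<or> f x \<in> openers"
      using closed involution no_fixpoint[of x] by (auto simp: openers_def)
    then show "x \<in> openers \<union> f ` openers"
      using involution[OF x] by (metis UnCI imageI)
  qed
  then have "S = openers \<union> f ` openers"
    using closed by (auto simp: openers_def)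
  then have "(\<Sum>x\<in>S. g x) = (\<Sum>x\<in>openers \<union> f ` openers. g x)"
    by (rule arg_cong)
  also have "\<dots> = (\<Sum>x\<in>openers. g x) + (\<Sum>x\<in>f ` openers. g x)"
    using finite_openers involution
    by (intro sum.union_disjoint) (force simp: openers_def)+
  also have "(\<Sum>x\<in>f ` openers. g x) = (\<Sum>a\<in>openers. g (f a))"
    by (subst sum.reindex[OF inj_on_inverseI[of _ f]]) (simp_all add: openers_def involution)
  finally show ?thesis
    by (simp add: sum.distrib)
qed

lemma card_openers: "2 * card openers = card S"
  using sum_eq_sum_openers[of "\<lambda>_. 1 :: nat"] by simp

lemma less_pairs_openers:
  "{(a, b) \<in> openers \<times> openers. a < b} = crossings \<union> alignments \<union> nestings"
proof -
  have "f a \<noteq> f b \<and> f a \<noteq> b" if "a \<in> openers" "b \<in> openers" "a < b" for a b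
    using that involution[of a] involution[of b] by (auto simp: openers_def)
  then show ?thesis
    unfolding crossings_def alignments_def nestings_def
    by (fastforce simp: openers_def neq_iff)
qed

definition arc_sum :: "('a \<Rightarrow> 'a \<Rightarrow> 'b::comm_monoid_add) \<Rightarrow> 'a \<Rightarrow> 'a \<Rightarrow> 'b" where
  "arc_sum g a b = g a b + g a (f b) + g (f a) b + g (f a) (f b)"

lemma sum_sum_eq_cards:
  fixes g :: "'a \<Rightarrow> 'a \<Rightarrow> 'b::comm_semiring_1"
  assumes same: "\<And>a. a \<in> openers \<Longrightarrow> arc_sum g a a = s"
    and crossing: "\<And>a b. (a, b) \<in> crossings \<Longrightarrow> arc_sum g a b + arc_sum g b a = c"
    and aligned: "\<And>a b. (a, b) \<in> alignments \<Longrightarrow> arc_sum g a b + arc_sum g b a = l"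
    and nested: "\<And>a b. (a, b) \<in> nestings \<Longrightarrow> arc_sum g a b + arc_sum g b a = r"
  shows "(\<Sum>x\<in>S. \<Sum>y\<in>S. g x y) = of_nat (card openers) * s + of_nat (card crossings) * c
    + of_nat (card alignments) * l + of_nat (card nestings) * r"
proof -
  let ?G = "\<lambda>(a, b). arc_sum g a b + arc_sum g b a"
  have fin: "finite crossings" "finite alignments" "finite nestings"
    using finite_openers
    by (auto simp: crossings_def alignments_def nestings_def
        intro: finite_subset[of _ "openers \<times> openers"])
  have "(\<Sum>x\<in>S. \<Sum>y\<in>S. g x y) = (\<Sum>a\<in>openers. \<Sum>b\<in>openers. arc_sum g a b)"
    by (simp add: sum_eq_sum_openers arc_sum_def sum.distrib add_ac)
  also have "\<dots> = (\<Sum>a\<in>openers. arc_sum g a a) + sum ?G (crossings \<union> alignments \<union> nestings)"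
    by (simp only: sum_sum_eq_sum_less_pairs finite_openers less_pairs_openers)
  also have "sum ?G (crossings \<union> alignments \<union> nestings)
      = sum ?G crossings + sum ?G alignments + sum ?G nestings"
    using fin by (subst sum.union_disjoint;
        (auto simp: crossings_def alignments_def nestings_def openers_def)?)+
  also have "sum ?G crossings = (\<Sum>_\<in>crossings. c)"
    using crossing by (intro sum.cong) auto
  also have "sum ?G alignments = (\<Sum>_\<in>alignments. l)"
    using aligned by (intro sum.cong) auto
  also have "sum ?G nestings = (\<Sum>_\<in>nestings. r)"
    using nested by (intro sum.cong) auto
  also have "(\<Sum>a\<in>openers. arc_sum g a a) = (\<Sum>_\<in>openers. s)"
    using same by (intro sum.cong) auto
  finally show ?thesis
    by (simp add: add_ac)
qed

lemma card_crossings_alignments_nestings: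
  "card S * card S = 2 * card S + 8 * (card crossings + card alignments + card nestings)"
  using sum_sum_eq_cards[of "\<lambda>_ _. 1 :: nat" 4 8 8 8] card_openers by (simp add: arc_sum_def)

lemma sum_sgn_eq_card_alignments:
  "(\<Sum>x\<in>S. \<Sum>y\<in>S. sgn (y - x) * sgn (y - f x)) = 8 * of_nat (card alignments)"
  by (subst sum_sum_eq_cards[where s = 0 and c = 0 and l = 8 and r = 0])
    (auto simp: arc_sum_def crossings_def alignments_def nestings_def openers_def involution sgn_if)

lemma sum_sgn_eq_card_alignments_nestings:
  "(\<Sum>x\<in>S. \<Sum>y\<in>S. sgn (y - x) * sgn (f y - f x))
    = 8 * of_nat (card alignments) - 8 * of_nat (card nestings) - of_nat (card S)"
  by (subst sum_sum_eq_cards[where s = "-2" and c = 0 and l = 8 and r = "-8"])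
    (auto simp: arc_sum_def crossings_def alignments_def nestings_def openers_def involution sgn_if
      simp flip: card_openers)

end

section \<open>Residues of least absolute value\<close>

lemma cong_cmod: "[x cmod l = x] (mod l)"
  using minus_cmod_eq_cdiv_mult[of x l] by (simp add: cong_sym_eq cong_iff_dvd_diff)

lemma cong_imp_cmod_eq: "[x = y] (mod l) \<Longrightarrow> x cmod l = y cmod l"
  unfolding centered_modulo_def by (metis cong_abs cong_add_rcancel cong_def)

lemma cmod_trivial:
  assumes "2 * \<bar>x\<bar> < l"
  shows "x cmod l = x"
  using assms by (simp add: centered_modulo_def mod_pos_pos_trivial)

lemma abs_cmod_less_odd:
  assumes "odd l"
  shows "2 * \<bar>x cmod l\<bar> < \<bar>l\<bar>"
proof -
  have "l \<noteq> 0" "2 * (\<bar>l\<bar> div 2) + 1 = \<bar>l\<bar>"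
    using assms odd_two_times_div_two_succ[of "\<bar>l\<bar>"] by auto
  then show ?thesis
    using abs_cmod_less_equal[of l x] by linarith
qed

lemma minus_cmod_eq:
  assumes "odd l"
  shows "(- x) cmod l = - (x cmod l)"
proof -
  have "- (x cmod l) cmod \<bar>l\<bar> = - (x cmod l)"
    using abs_cmod_less_odd[OF assms] by (intro cmod_trivial) simp
  moreover have "(- x) cmod l = - (x cmod l) cmod l"
    using cong_cmod[of x l] by (intro cong_imp_cmod_eq cong_uminus) (rule cong_sym)
  ultimately show ?thesis
    by simp
qed

lemma tilde_eq_min_mod: "0 < p \<Longrightarrow> tilde p x = min (x mod p) (p - x mod p)"
  by (auto simp: tilde_def)

lemma tilde_cong: "[x = y] (mod p) \<Longrightarrow> tilde p x = tilde p y"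
  by (simp add: tilde_def cong_def)

lemma tilde_minus: "0 < p \<Longrightarrow> tilde p (- x) = tilde p x"
  by (simp add: tilde_eq_min_mod zmod_zminus1_eq_if min.commute)

lemma tilde_eq_min_abs:
  assumes "0 < p" and "\<bar>x\<bar> \<le> p"
  shows "tilde p x = min \<bar>x\<bar> (p - \<bar>x\<bar>)"
proof -
  have "tilde p \<bar>x\<bar> = min \<bar>x\<bar> (p - \<bar>x\<bar>)"
    using assms by (cases "\<bar>x\<bar> = p") (simp_all add: tilde_eq_min_mod)
  then show ?thesis
    using assms(1) by (simp add: abs_if tilde_minus split: if_splits)
qed

lemma tilde_eq_abs_cmod:
  assumes "0 < p"
  shows "tilde p x = \<bar>x cmod p\<bar>"
proof -
  have "tilde p x = tilde p (x cmod p)"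
    by (rule tilde_cong) (simp add: cong_cmod cong_sym)
  also have "\<dots> = \<bar>x cmod p\<bar>"
    using assms abs_cmod_less_equal[of p x] by (subst tilde_eq_min_abs) auto
  finally show ?thesis .
qed

lemma tilde_0 [simp]: "0 < p \<Longrightarrow> tilde p 0 = 0"
  by (simp add: tilde_eq_min_mod)

lemma tilde_nonneg: "0 < p \<Longrightarrow> 0 \<le> tilde p x"
  by (simp add: tilde_eq_abs_cmod)

lemma tilde_le_half: "0 < p \<Longrightarrow> tilde p x \<le> p div 2"
  using abs_cmod_less_equal[of p x] by (simp add: tilde_eq_abs_cmod)

lemma tilde_mult_tilde:
  assumes "0 < p"
  shows "tilde p (c * tilde p x) = tilde p (c * x)"
proof -
  have "tilde p (c * tilde p x) = tilde p (c * (x cmod p))"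
    using assms by (simp add: tilde_eq_abs_cmod[of p x] abs_if tilde_minus)
  also have "\<dots> = tilde p (c * x)"
    by (intro tilde_cong cong_scalar_left cong_cmod)
  finally show ?thesis .
qed

lemma tilde_add_diff:
  assumes "0 < p"
  shows "tilde p (v + u) = min \<bar>v cmod p + u cmod p\<bar> (p - \<bar>v cmod p + u cmod p\<bar>)" (is ?add)
    and "tilde p (v - u) = min \<bar>v cmod p - u cmod p\<bar> (p - \<bar>v cmod p - u cmod p\<bar>)" (is ?diff)
proof -
  have "\<bar>v cmod p\<bar> \<le> p div 2" "\<bar>u cmod p\<bar> \<le> p div 2"
    using assms abs_cmod_less_equal[of p] by auto
  then have "\<bar>v cmod p + u cmod p\<bar> \<le> p" "\<bar>v cmod p - u cmod p\<bar> \<le> p"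
    by linarith+
  moreover have "[v + u = v cmod p + u cmod p] (mod p)" "[v - u = v cmod p - u cmod p] (mod p)"
    by (simp_all add: cong_add cong_diff cong_cmod cong_sym)
  ultimately show ?add ?diff
    using assms by (simp_all add: tilde_cong tilde_eq_min_abs)
qed

lemma min_tilde_add_diff:
  assumes "0 < p"
  shows "min (tilde p (v + u)) (tilde p (v - u)) = \<bar>tilde p v - tilde p u\<bar>"
proof -
  define a b where "a = u cmod p" and "b = v cmod p"
  have "2 * \<bar>a\<bar> \<le> p" "2 * \<bar>b\<bar> \<le> p"
    using assms abs_cmod_less_equal[of p u] abs_cmod_less_equal[of p v]
    unfolding a_def b_def by linarith+
  then show ?thesis
    unfolding tilde_add_diff[OF assms] tilde_eq_abs_cmod[OF assms, of u]
      tilde_eq_abs_cmod[OF assms, of v] a_def[symmetric] b_def[symmetric]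
    by (smt (verit))
qed

lemma sgn_tilde_add_diff:
  assumes "0 < p" and "odd p"
  shows "sgn (tilde p (v + u) - tilde p (v - u)) = sgn (u cmod p) * sgn (v cmod p)"
proof -
  define a b where "a = u cmod p" and "b = v cmod p"
  let ?m = "\<lambda>x. min \<bar>x\<bar> (p - \<bar>x\<bar>)"
  have bounds: "2 * \<bar>a\<bar> < p" "2 * \<bar>b\<bar> < p"
    using assms abs_cmod_less_odd[of p u] abs_cmod_less_odd[of p v] by (simp_all add: a_def b_def)
  have "?m (b - a) < ?m (b + a)" if "0 < a \<and> 0 < b \<or> a < 0 \<and> b < 0"
    using that bounds by (smt (verit))
  moreover have "?m (b + a) < ?m (b - a)" if "0 < a \<and> b < 0 \<or> a < 0 \<and> 0 < b"
    using that bounds by (smt (verit))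
  ultimately have "sgn (?m (b + a) - ?m (b - a)) = sgn a * sgn b"
    by (cases a "0 :: int" rule: linorder_cases; cases b "0 :: int" rule: linorder_cases) simp_all
  then show ?thesis
    unfolding tilde_add_diff[OF assms(1)] a_def b_def .
qed

section \<open>Sums over integer intervals and residue systems\<close>

lemma sum_sgn_mult_sgn_interval:
  fixes l u x z :: int
  assumes "x \<in> {l..u}" and "z \<in> {l..u}" and "x \<noteq> z"
  shows "(\<Sum>y\<in>{l..u}. sgn (y - x) * sgn (y - z)) = u - l + 1 - 2 * \<bar>z - x\<bar>"
  using assms
proof (induction x z rule: linorder_wlog)
  case (le x z)
  have "(\<Sum>y\<in>{l..u}. sgn (y - x) * sgn (y - z))
      = (\<Sum>y\<in>{l..u}. 1 - of_bool (x \<le> y \<and> y < z) - of_bool (x < y \<and> y \<le> z))"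
    using le by (intro sum.cong) auto
  also have "\<dots> = u - l + 1 - int (card ({l..u} \<inter> {y. x \<le> y \<and> y < z}))
      - int (card ({l..u} \<inter> {y. x < y \<and> y \<le> z}))"
    using le by (simp add: sum_subtractf)
  also have "{l..u} \<inter> {y. x \<le> y \<and> y < z} = {x..<z}"
    using le by auto
  also have "{l..u} \<inter> {y. x < y \<and> y \<le> z} = {x<..z}"
    using le by auto
  finally show ?case
    using le by simp
next
  case (sym x z)
  then show ?case
    by (simp add: mult.commute abs_minus_commute)
qed

lemma sum_symmetric_interval_even:
  fixes g :: "int \<Rightarrow> 'a::comm_semiring_1"
  assumes "0 \<le> n" and even: "\<And>x. g (- x) = g x"
  shows "(\<Sum>x\<in>{-n..n}. g x) = g 0 + 2 * (\<Sum>x\<in>{1..n}. g x)"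
proof -
  have "{-n..n} = insert 0 ({1..n} \<union> {-n..-1})"
    using assms(1) by auto
  moreover have "(\<Sum>x\<in>{-n..-1}. g x) = (\<Sum>x\<in>{1..n}. g x)"
    by (rule sum.reindex_bij_witness[where i = uminus and j = uminus]) (auto simp: even)
  ultimately show ?thesis
    by (simp add: sum.union_disjoint mult_2)
qed

lemma sum_sum_symmetric_interval_even:
  fixes g :: "int \<Rightarrow> int \<Rightarrow> 'a::comm_semiring_1"
  assumes "0 \<le> n" and "\<And>x y. g (- x) y = g x y" "\<And>x y. g x (- y) = g x y"
  shows "(\<Sum>x\<in>{-n..n}. \<Sum>y\<in>{-n..n}. g x y) = g 0 0 + 2 * (\<Sum>x\<in>{1..n}. g x 0)
    + 2 * (\<Sum>y\<in>{1..n}. g 0 y) + 4 * (\<Sum>x\<in>{1..n}. \<Sum>y\<in>{1..n}. g x y)"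
proof -
  have "(\<Sum>x\<in>{-n..n}. \<Sum>y\<in>{-n..n}. g x y) = (\<Sum>x\<in>{-n..n}. g x 0 + 2 * (\<Sum>y\<in>{1..n}. g x y))"
    by (intro sum.cong refl sum_symmetric_interval_even assms)
  also have "\<dots> = g 0 0 + 2 * (\<Sum>y\<in>{1..n}. g 0 y)
      + 2 * (\<Sum>x\<in>{1..n}. g x 0 + 2 * (\<Sum>y\<in>{1..n}. g x y))"
    by (rule sum_symmetric_interval_even) (simp_all only: assms)
  finally show ?thesis
    by (simp add: sum.distrib sum_distrib_left distrib_left add_ac flip: mult.assoc)
qed

locale odd_modulus =
  fixes p n :: int
  assumes modulus_eq: "p = 2 * n + 1" and half_nonneg: "0 \<le> n"
begin

lemma modulus_pos: "0 < p" and modulus_odd: "odd p"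
  using modulus_eq half_nonneg by auto

lemma cmod_in_residues: "x cmod p \<in> {-n..n}"
  using abs_cmod_less_equal[of p x] modulus_eq half_nonneg by auto

lemma cmod_eq_self: "x \<in> {-n..n} \<Longrightarrow> x cmod p = x"
  using modulus_eq by (intro cmod_trivial) auto

lemma tilde_eq_self: "x \<in> {1..n} \<Longrightarrow> tilde p x = x"
  using modulus_pos by (simp add: tilde_eq_abs_cmod cmod_eq_self)

lemma sum_residues_affine:
  fixes g :: "int \<Rightarrow> 'a::comm_monoid_add"
  assumes "coprime c p" and periodic: "\<And>x y. [x = y] (mod p) \<Longrightarrow> g x = g y"
  shows "(\<Sum>x\<in>{-n..n}. g (c * x + d)) = (\<Sum>x\<in>{-n..n}. g x)"
proof -
  let ?h = "\<lambda>x. (c * x + d) cmod p"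
  have inj: "inj_on ?h {-n..n}"
  proof (rule inj_onI)
    fix x y assume xy: "x \<in> {-n..n}" "y \<in> {-n..n}" "?h x = ?h y"
    then have "[c * x + d = c * y + d] (mod p)"
      by (metis cong_cmod cong_sym cong_trans)
    then have "[x = y] (mod p)"
      using assms(1) by (simp add: cong_add_rcancel cong_mult_lcancel)
    then show "x = y"
      using xy by (metis cmod_eq_self cong_imp_cmod_eq)
  qed
  moreover have "?h ` {-n..n} \<subseteq> {-n..n}"
    using cmod_in_residues by blast
  ultimately have "?h ` {-n..n} = {-n..n}"
    by (simp add: endo_inj_surj)
  then have "(\<Sum>x\<in>{-n..n}. g x) = (\<Sum>x\<in>{-n..n}. g (?h x))"
    using sum.reindex[OF inj, of g] by simp
  then show ?thesis
    using periodic[OF cong_cmod] by simp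
qed

lemma sum_residues_rotate:
  fixes g :: "int \<Rightarrow> int \<Rightarrow> 'a::comm_monoid_add"
  assumes periodic: "\<And>x x' y y'. [x = x'] (mod p) \<Longrightarrow> [y = y'] (mod p) \<Longrightarrow> g x y = g x' y'"
  shows "(\<Sum>x\<in>{-n..n}. \<Sum>y\<in>{-n..n}. g x y)
    = (\<Sum>u\<in>{-n..n}. \<Sum>v\<in>{-n..n}. g (v - u) (v + u))"
proof -
  have "(\<Sum>x\<in>{-n..n}. \<Sum>y\<in>{-n..n}. g x y) = (\<Sum>x\<in>{-n..n}. \<Sum>u\<in>{-n..n}. g x (2 * u + x))"
    by (intro sum.cong refl sum_residues_affine[symmetric])
      (simp_all add: periodic modulus_odd)
  also have "\<dots> = (\<Sum>u\<in>{-n..n}. \<Sum>x\<in>{-n..n}. g x (2 * u + x))"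
    by (rule sum.swap)
  also have "\<dots> = (\<Sum>u\<in>{-n..n}. \<Sum>v\<in>{-n..n}. g (v - u) (v + u))"
  proof (rule sum.cong[OF refl])
    fix u
    have "(\<Sum>v\<in>{-n..n}. g (1 * v + - u) (2 * u + (1 * v + - u))) = (\<Sum>x\<in>{-n..n}. g x (2 * u + x))"
      by (rule sum_residues_affine) (simp_all add: periodic cong_add)
    then show "(\<Sum>x\<in>{-n..n}. g x (2 * u + x)) = (\<Sum>v\<in>{-n..n}. g (v - u) (v + u))"
      by (simp add: algebra_simps)
  qed
  finally show ?thesis .
qed

lemma tilde_mult_in:
  assumes "coprime c p" and "x \<in> {1..n}"
  shows "tilde p (c * x) \<in> {1..n}"
proof -
  have "tilde p (c * x) \<noteq> 0"
  proof
    assume "tilde p (c * x) = 0"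
    then have "[c * x = c * 0] (mod p)"
      using cong_cmod[of "c * x" p] modulus_pos by (simp add: tilde_eq_abs_cmod cong_sym)
    then have "[x = 0] (mod p)"
      using assms(1) cong_mult_lcancel by blast
    then show False
      using tilde_cong[of x 0 p] assms(2) modulus_pos by (simp add: tilde_eq_self)
  qed
  then show ?thesis
    using tilde_nonneg[OF modulus_pos, of "c * x"] tilde_le_half[OF modulus_pos, of "c * x"]
      modulus_eq by simp
qed

lemma bij_betw_tilde_mult:
  assumes "coprime c p"
  shows "bij_betw (\<lambda>x. tilde p (c * x)) {1..n} {1..n}"
proof -
  obtain d where d: "[c * d = 1] (mod p)"
    using assms by (auto dest: cong_solve_coprime_int)
  have "tilde p (d * tilde p (c * x)) = x" if "x \<in> {1..n}" for x
  proof -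
    have "[c * d * x = 1 * x] (mod p)"
      using d by (rule cong_scalar_right)
    then have "tilde p (d * (c * x)) = x"
      using tilde_cong[of "d * (c * x)" x p] that by (simp add: tilde_eq_self mult_ac)
    then show ?thesis
      by (simp add: tilde_mult_tilde modulus_pos)
  qed
  then have "inj_on (\<lambda>x. tilde p (c * x)) {1..n}"
    by (rule inj_on_inverseI)
  moreover have "(\<lambda>x. tilde p (c * x)) ` {1..n} \<subseteq> {1..n}"
    using tilde_mult_in[OF assms] by blast
  ultimately show ?thesis
    by (simp add: bij_betw_def endo_inj_surj)
qed

lemma sum_residues_sgn_tilde_diff:
  "(\<Sum>x\<in>{-n..n}. \<Sum>y\<in>{-n..n}.
      sgn (tilde p y - tilde p x) * sgn (tilde p (c * y) - tilde p (c * x)))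
    = (\<Sum>u\<in>{-n..n}. sgn u * sgn (c * u cmod p))\<^sup>2"
proof -
  let ?g = "\<lambda>x y. sgn (tilde p y - tilde p x) * sgn (tilde p (c * y) - tilde p (c * x))"
  have periodic: "?g x y = ?g x' y'" if "[x = x'] (mod p)" "[y = y'] (mod p)" for x x' y y'
    using that[THEN tilde_cong] that[THEN cong_scalar_left, THEN tilde_cong, of c] by simp
  have "(\<Sum>x\<in>{-n..n}. \<Sum>y\<in>{-n..n}. ?g x y)
      = (\<Sum>u\<in>{-n..n}. \<Sum>v\<in>{-n..n}. ?g (v - u) (v + u))"
    by (rule sum_residues_rotate) (rule periodic)
  also have "\<dots> = (\<Sum>u\<in>{-n..n}. \<Sum>v\<in>{-n..n}.
      sgn u * sgn (c * u cmod p) * (sgn v * sgn (c * v cmod p)))"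
  proof (intro sum.cong refl)
    fix u v assume "u \<in> {-n..n}" "v \<in> {-n..n}"
    then show "?g (v - u) (v + u) = sgn u * sgn (c * u cmod p) * (sgn v * sgn (c * v cmod p))"
      using sgn_tilde_add_diff[OF modulus_pos modulus_odd, of v u]
        sgn_tilde_add_diff[OF modulus_pos modulus_odd, of "c * v" "c * u"]
      by (simp add: distrib_left right_diff_distrib cmod_eq_self)
  qed
  finally show ?thesis
    by (simp add: power2_eq_square sum_product)
qed

lemma sum_sgn_tilde_diff:
  assumes "coprime c p"
  shows "(\<Sum>x\<in>{1..n}. \<Sum>y\<in>{1..n}. sgn (y - x) * sgn (tilde p (c * y) - tilde p (c * x)))
    = (\<Sum>u\<in>{1..n}. sgn (c * u cmod p))\<^sup>2 - n"
proof -
  let ?h = "\<lambda>x y. sgn (tilde p y - tilde p x) * sgn (tilde p (c * y) - tilde p (c * x))"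
  have axes: "?h x 0 = 1" "?h 0 x = 1" if "x \<in> {1..n}" for x
    using that tilde_mult_in[OF assms that] modulus_pos by (simp_all add: tilde_eq_self)
  have "(\<Sum>u\<in>{-n..n}. sgn u * sgn (c * u cmod p)) = 2 * (\<Sum>u\<in>{1..n}. sgn u * sgn (c * u cmod p))"
    using half_nonneg
    by (subst sum_symmetric_interval_even) (simp_all add: minus_cmod_eq modulus_odd)
  also have "(\<Sum>u\<in>{1..n}. sgn u * sgn (c * u cmod p)) = (\<Sum>u\<in>{1..n}. sgn (c * u cmod p))"
    by (intro sum.cong) auto
  finally have "4 * (\<Sum>u\<in>{1..n}. sgn (c * u cmod p))\<^sup>2 = (\<Sum>x\<in>{-n..n}. \<Sum>y\<in>{-n..n}. ?h x y)"
    by (simp add: sum_residues_sgn_tilde_diff power_mult_distrib)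
  also have "\<dots> = ?h 0 0 + 2 * (\<Sum>x\<in>{1..n}. ?h x 0) + 2 * (\<Sum>y\<in>{1..n}. ?h 0 y)
      + 4 * (\<Sum>x\<in>{1..n}. \<Sum>y\<in>{1..n}. ?h x y)"
    using half_nonneg modulus_pos
    by (intro sum_sum_symmetric_interval_even) (simp_all add: tilde_minus)
  also have "\<dots> = 4 * n + 4 * (\<Sum>x\<in>{1..n}. \<Sum>y\<in>{1..n}. ?h x y)"
    using half_nonneg by (simp only: axes cong: sum.cong) simp
  also have "(\<Sum>x\<in>{1..n}. \<Sum>y\<in>{1..n}. ?h x y)
      = (\<Sum>x\<in>{1..n}. \<Sum>y\<in>{1..n}. sgn (y - x) * sgn (tilde p (c * y) - tilde p (c * x)))"
    by (intro sum.cong refl) (simp add: tilde_eq_self)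
  finally show ?thesis
    by simp
qed

end

section \<open>Square roots of \<open>-1\<close>\<close>

lemma fact_half_square:
  assumes "prime (2 * n + 1)"
  shows "[(fact n)\<^sup>2 = (- 1) ^ Suc n] (mod int (2 * n + 1))"
proof -
  define p where "p = 2 * n + 1"
  have "fact (2 * n) = (\<Prod>i\<in>{n..<2 * n}. int (Suc i)) * fact n"
    using fact_split[of n "2 * n", where 'a = int] by simp
  also have "(\<Prod>i\<in>{n..<2 * n}. int (Suc i)) = (\<Prod>k\<in>{1..n}. int p - int k)"
    by (rule prod.reindex_bij_witness[where i = "\<lambda>k. 2 * n - k" and j = "\<lambda>i. 2 * n - i"])
      (auto simp: p_def)
  also have "[\<dots> * fact n = (\<Prod>k\<in>{1..n}. - int k) * fact n] (mod int p)"
    by (intro cong_scalar_right cong_prod) (simp add: cong_iff_dvd_diff)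
  also have "(\<Prod>k\<in>{1..n}. - int k) = (- 1) ^ n * fact n"
    by (simp add: prod_uminus fact_prod)
  finally have "[(- 1) ^ n * (fact n)\<^sup>2 = fact (2 * n)] (mod int p)"
    by (simp add: power2_eq_square cong_sym mult.assoc)
  also have "[fact (2 * n) = - 1] (mod int p)"
    using wilson_theorem[OF assms] by (simp add: p_def)
  finally have "[(- 1) ^ n * ((- 1) ^ n * (fact n)\<^sup>2) = (- 1) ^ n * (- 1)] (mod int p)"
    by (rule cong_scalar_left)
  then show ?thesis
    by (simp add: p_def)
qed

lemma tval_mult_tval_cong:
  assumes "prime p" and "[p = 1] (mod 4)"
  shows "[tval p * tval p = - 1] (mod p)"
proof -
  have "0 < p" "p mod 4 = 1"
    using assms prime_gt_0_int by (auto simp: cong_def)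
  then obtain n where p_eq: "p = 2 * int n + 1" and "even n"
    using that[of "2 * nat (p div 4)"] div_mult_mod_eq[of p 4] by simp
  have "prime (2 * n + 1)"
    using assms(1) prime_nat_int_transfer[of "2 * n + 1"] by (simp add: p_eq add.commute)
  moreover have "tval p = fact n"
    using prod_int_eq[of 1 n] by (simp add: p_eq tval_def fact_prod)
  ultimately show ?thesis
    using fact_half_square[of n] \<open>even n\<close> by (simp add: p_eq power2_eq_square add.commute)
qed

locale sqrt_minus_one = odd_modulus +
  fixes t :: int
  assumes t_square_cong: "[t * t = - 1] (mod p)"
begin

abbreviation bar :: "int \<Rightarrow> int" where
  "bar x \<equiv> tilde p (t * x)"

lemma coprime_t: "coprime t p"
proof -
  have "coprime (t * t) p"
    using cong_imp_coprime[OF cong_sym[OF t_square_cong]] by simp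
  then show ?thesis
    by simp
qed

lemma coprime_t_diff_1: "coprime (t - 1) p"
proof -
  have "[- 2 = (t - 1) * (t + 1)] (mod p)"
    using cong_diff[OF cong_sym[OF t_square_cong] cong_refl[of 1]] by (simp add: algebra_simps)
  then have "coprime ((t - 1) * (t + 1)) p"
    by (rule cong_imp_coprime) (simp add: modulus_odd)
  then show ?thesis
    by simp
qed

lemma bar_in: "x \<in> {1..n} \<Longrightarrow> bar x \<in> {1..n}"
  by (rule tilde_mult_in[OF coprime_t])

lemma t_mult_t_mult_cong: "[t * (t * x) = - x] (mod p)"
  using cong_scalar_right[OF t_square_cong, of x] by (simp add: mult.assoc)

lemma bar_bar: "x \<in> {1..n} \<Longrightarrow> bar (bar x) = x"
  using tilde_cong[OF t_mult_t_mult_cong, of x] modulus_pos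
  by (simp add: tilde_mult_tilde tilde_minus tilde_eq_self)

text \<open>Since \<open>t (t - 1) = - (t + 1)\<close>, multiplication by \<open>t - 1\<close> turns the pair \<open>(x, bar x)\<close> into
  the residues of \<open>bar x \<plusminus> x\<close>, the smaller of which is \<open>\<bar>bar x - x\<bar>\<close>.\<close>

lemma abs_bar_diff:
  assumes "x \<in> {1..n}"
  shows "\<bar>bar x - x\<bar> = min (tilde p ((t - 1) * x)) (bar (tilde p ((t - 1) * x)))"
proof -
  have "[t * ((t - 1) * x) = - (t * x + x)] (mod p)"
    using cong_diff[OF t_mult_t_mult_cong cong_refl, of x "t * x"] by (simp add: algebra_simps)
  then have "bar (tilde p ((t - 1) * x)) = tilde p (t * x + x)"
    using tilde_cong modulus_pos tilde_minus tilde_mult_tilde by metis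
  moreover have "tilde p ((t - 1) * x) = tilde p (t * x - x)"
    by (simp add: left_diff_distrib)
  ultimately show ?thesis
    using min_tilde_add_diff[OF modulus_pos, of "t * x" x] assms
    by (simp add: tilde_eq_self min.commute)
qed

lemma bar_neq:
  assumes "x \<in> {1..n}"
  shows "bar x \<noteq> x"
  using abs_bar_diff[OF assms] tilde_mult_in[OF coprime_t_diff_1 assms] bar_in by fastforce

sublocale arcs: fixpoint_free_involution "{1..n}" bar
  by unfold_locales (use bar_in bar_bar bar_neq in \<open>blast intro: finite_atLeastAtMost_int\<close>)+

lemma sum_bar: "(\<Sum>x\<in>{1..n}. g (bar x)) = (\<Sum>x\<in>{1..n}. g x)"
  for g :: "int \<Rightarrow> 'a::comm_monoid_add"
  using sum.reindex_bij_betw[OF bij_betw_tilde_mult[OF coprime_t]] .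

lemma sum_abs_bar_diff: "3 * (\<Sum>x\<in>{1..n}. \<bar>bar x - x\<bar>) = n * (n + 1)"
proof -
  have "(\<Sum>x\<in>{1..n}. \<bar>bar x - x\<bar>) = (\<Sum>x\<in>{1..n}. min x (bar x))"
    using sum.reindex_bij_betw[OF bij_betw_tilde_mult[OF coprime_t_diff_1], of "\<lambda>x. min x (bar x)"]
    by (simp add: abs_bar_diff)
  moreover have "2 * (\<Sum>x\<in>{1..n}. min x (bar x)) + (\<Sum>x\<in>{1..n}. \<bar>bar x - x\<bar>)
      = (\<Sum>x\<in>{1..n}. x + bar x)"
    by (simp add: sum_distrib_left flip: sum.distrib) (intro sum.cong; simp)
  moreover have "(\<Sum>x\<in>{1..n}. x + bar x) = 2 * (\<Sum>x\<in>{1..n}. x)"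
    using sum_bar[of "\<lambda>x. x"] by (simp add: sum.distrib)
  moreover have "2 * (\<Sum>x\<in>{1..n}. x) = n * (n + 1)"
    using Sum_Icc_int[of 1 n] half_nonneg by (cases "n = 0") auto
  ultimately show ?thesis
    by simp
qed

lemma sum_sgn_cmod_eq_0: "(\<Sum>x\<in>{1..n}. sgn (t * x cmod p)) = 0"
proof -
  have "sgn (t * bar x cmod p) = - sgn (t * x cmod p)" if x: "x \<in> {1..n}" for x
  proof -
    define r where "r = t * x cmod p"
    have bar_x: "bar x = \<bar>r\<bar>" "r \<noteq> 0"
      using bar_in[OF x] modulus_pos by (auto simp: r_def tilde_eq_abs_cmod)
    have "[t * r = - x] (mod p)"
      unfolding r_def by (rule cong_trans[OF cong_scalar_left[OF cong_cmod] t_mult_t_mult_cong])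
    then have "t * r cmod p = - x"
      using x by (simp add: cong_imp_cmod_eq minus_cmod_eq modulus_odd cmod_eq_self)
    then have "sgn (t * \<bar>r\<bar> cmod p) = - sgn r"
      using x bar_x(2) by (cases "0 < r") (simp_all add: minus_cmod_eq modulus_odd)
    then show ?thesis
      unfolding bar_x(1) by (simp add: r_def)
  qed
  then have "(\<Sum>x\<in>{1..n}. sgn (t * x cmod p)) = - (\<Sum>x\<in>{1..n}. sgn (t * x cmod p))"
    using sum_bar[of "\<lambda>x. sgn (t * x cmod p)"] by (simp add: sum_negf)
  then show ?thesis
    by simp
qed

lemma card_alignments: "24 * int (card arcs.alignments) = n * (n - 2)"
proof -
  have "8 * int (card arcs.alignments)
      = (\<Sum>x\<in>{1..n}. \<Sum>y\<in>{1..n}. sgn (y - x) * sgn (y - bar x))"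
    using arcs.sum_sgn_eq_card_alignments by simp
  also have "\<dots> = (\<Sum>x\<in>{1..n}. n - 2 * \<bar>bar x - x\<bar>)"
    using bar_in bar_neq sum_sgn_mult_sgn_interval[of _ 1 n] by (intro sum.cong refl) fastforce
  also have "\<dots> = n * n - 2 * (\<Sum>x\<in>{1..n}. \<bar>bar x - x\<bar>)"
    using half_nonneg by (simp add: sum_subtractf sum_distrib_left)
  finally show ?thesis
    using sum_abs_bar_diff by (simp add: algebra_simps)
qed

lemma card_nestings_eq_card_alignments: "card arcs.nestings = card arcs.alignments"
proof -
  have "8 * int (card arcs.alignments) - 8 * int (card arcs.nestings) - n
      = (\<Sum>x\<in>{1..n}. \<Sum>y\<in>{1..n}. sgn (y - x) * sgn (bar y - bar x))"
    using arcs.sum_sgn_eq_card_alignments_nestings half_nonneg by simp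
  also have "\<dots> = (\<Sum>x\<in>{1..n}. sgn (t * x cmod p))\<^sup>2 - n"
    by (rule sum_sgn_tilde_diff[OF coprime_t])
  finally show ?thesis
    by (simp add: sum_sgn_cmod_eq_0)
qed

lemma card_crossings_eq_card_alignments: "card arcs.crossings = card arcs.alignments"
proof -
  have "n * n = 2 * n
      + 8 * (int (card arcs.crossings) + int (card arcs.alignments) + int (card arcs.nestings))"
    using arg_cong[OF arcs.card_crossings_alignments_nestings, of int] half_nonneg by simp
  then show ?thesis
    using card_alignments card_nestings_eq_card_alignments by (simp add: algebra_simps)
qed

end

theorem theorem3p5:
  fixes p :: int
  assumes "prime p" and "[p = 1] (mod 4)"
  shows "card (X p) = card (Y p) \<and> card (Y p) = card (Z p) \<and>
    real (card (Z p)) = (real_of_int p - 1) * (real_of_int p - 5) / 96"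
proof -
  define n where "n = (p - 1) div 2"
  have "1 < p" "p mod 4 = 1"
    using assms prime_gt_1_int by (auto simp: cong_def)
  then have p_eq: "p = 2 * n + 1" and "0 \<le> n"
    unfolding n_def by presburger+
  then interpret sqrt_minus_one p n "tval p"
    using tval_mult_tval_cong[OF assms] by unfold_locales
  have "V p = arcs.openers"
    by (auto simp: V_def arcs.openers_def simp flip: n_def)
  then have "X p = arcs.crossings" "Y p = arcs.alignments" "Z p = arcs.nestings"
    by (auto simp: X_def Y_def Z_def pbar_def arcs.crossings_def arcs.alignments_def
        arcs.nestings_def arcs.openers_def)
  moreover have "24 * real (card arcs.alignments) = real_of_int n * (real_of_int n - 2)"
    using arg_cong[OF card_alignments, of real_of_int] by simp
  ultimately show ?thesis
    by (simp add: card_nestings_eq_card_alignments card_crossings_eq_card_alignments)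
      (simp add: p_eq field_simps)
qed

end
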